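(* Consider agents $i\in\mathcal N=\{1,\ldots,N\}$ with dynamics $\dot x_i(t)=u_i(t)$, $x_i(t),u_i(t)\in\mathbb R^2$, and their time-varying connectivity graph $G(t)=(\mathcal N,E(t))$ (with communication radius $r>0$ and hysteresis constant $\varepsilon\in(0,r)$). Assume that $G(t)$ is connected at $t=T_1$ and that agent $\ell\in\mathcal N$ is the fixed leader for all $t\ge T_1$, with fixed goal region $R_{\ell g}$ with center $c_{\ell g}\in\mathbb R^2$. Suppose every agent $i$ applies, for $t\ge T_1$, the controller $$u_i(t)=-b_i\,(x_i-c_{ig})-\sum_{j\in\mathcal N_i(t)}\frac{2r^2}{(r^2-\|x_{ij}\|^2)^2}\,(x_i-x_j),$$ where $b_\ell=1$ and $b_i=0$ for $i\ne\ell$. Then $G(t)$ remains connected and $E(T_1)\subseteq E(t)$ for all $t\ge T_1$.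
   Context: There are $N$ agents $\mathcal N=\{1,\ldots,N\}$; $x_i(t)\in\mathbb R^2$ is the state (position) of agent $i$ at time $t$, with given initial state $x_i(0)$, and $x_{ij}(t)=x_i(t)-x_j(t)$. All agents have communication radius $r>0$, and $\varepsilon\in(0,r)$ is a given constant. Connectivity graph: $G(t)=(\mathcal N,E(t))$ is the undirected time-varying graph with $E(0)=\{(i,j)\mid \|x_i(0)-x_j(0)\|<r\}$ and, for $t>0$, $(i,j)\in E(t)$ if and only if either (i) $\|x_i(t)-x_j(t)\|\le r-\varepsilon$, or (ii) $r-\varepsilon<\|x_i(t)-x_j(t)\|\le r$ and $(i,j)\in E(t^-)$, where $t^-<t$ and $|t-t^-|\to 0$ (i.e. the edge was present immediately before $t$). The neighbour set of $i$ is $\mathcal N_i(t)=\{i'\in\mathcal N\mid (i,i')\in E(t)\}$. The interaction term of the controller is the gradient with respect to $x_i$ of the potential $\phi(\|x_{ij}\|)=\frac{\|x_{ij}\|^2}{r^2-\|x_{ij}\|^2}$, which is defined for $\|x_{ij}\|\in[0,r)$. The indicator $b_i\in\{0,1\}$ equals $1$ if and only if agent $i$ is the leader. A goal region of agent $\ell$ is a disc $R_{\ell g}=\{y\in\mathbb R^2\mid \|y-c_{\ell g}\|\le r_{\ell g}\}$ with $r_{\ell g}\ge r_{\min}>0$. *)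

theory Defs
  imports "HOL-Analysis.Analysis" "Graph_Theory.Graph_Theory"
begin

text \<open>
  Link status at time \<open>t\<close> of one pair of agents, where \<open>d\<close> is their distance as a function of
  time. The rule for \<open>t > 0\<close> is informally
  \<open>d t \<le> r - \<epsilon>\<close>, or \<open>r - \<epsilon> < d t \<le> r\<close> and the link is present at \<open>t\<^sup>-\<close>.
  Over a continuum of times this equivalence alone does not determine the link status: with \<open>d\<close>
  constant in the band \<open>(r - \<epsilon>, r)\<close>, a link that vanishes (or emerges) spontaneously right after
  some time also satisfies it. The intended memory is that a link, once present, is kept while the
  distance remains in the band; this is what rule \<open>hysteresis\<close> says. The theorem
  \<open>linked_iff_left_limit\<close> recovers the informal rule, with \<open>t\<^sup>-\<close> read as \<open>at_left t\<close>.
\<close>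

inductive linked :: "real \<Rightarrow> real \<Rightarrow> (real \<Rightarrow> real) \<Rightarrow> real \<Rightarrow> bool"
  for r :: real and \<epsilon> :: real and d :: "real \<Rightarrow> real" where
  initial: "d 0 < r \<Longrightarrow> linked r \<epsilon> d 0"
| close: "0 < t \<Longrightarrow> d t \<le> r - \<epsilon> \<Longrightarrow> linked r \<epsilon> d t"
| hysteresis: "linked r \<epsilon> d s \<Longrightarrow> s < t \<Longrightarrow> (\<forall>\<tau>\<in>{s<..t}. r - \<epsilon> < d \<tau> \<and> d \<tau> \<le> r)
    \<Longrightarrow> linked r \<epsilon> d t"

lemma linked_nonneg: "linked r \<epsilon> d t \<Longrightarrow> 0 \<le> t"
  by (induction rule: linked.induct) auto

lemma linked_le:
  assumes "0 < \<epsilon>" "linked r \<epsilon> d t"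
  shows "d t \<le> r"
  using assms(2) by cases (use assms(1) in auto)

lemma linked_0_iff: "linked r \<epsilon> d 0 \<longleftrightarrow> d 0 < r"
proof
  assume "linked r \<epsilon> d 0"
  then show "d 0 < r" by cases (auto dest: linked_nonneg)
qed (rule linked.initial)

theorem linked_iff_left_limit:
  assumes "0 < \<epsilon>" "0 < t" and cont: "continuous_on {0..} d"
  shows "linked r \<epsilon> d t \<longleftrightarrow>
    d t \<le> r - \<epsilon> \<or> (r - \<epsilon> < d t \<and> d t \<le> r \<and> (\<forall>\<^sub>F s in at_left t. linked r \<epsilon> d s))"
    (is "?L \<longleftrightarrow> ?R")
proof
  assume ?L
  then show ?R
  proof cases
    case (hysteresis s)
    have "linked r \<epsilon> d \<tau>" if "s < \<tau>" "\<tau> < t" for \<tau>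
      using hysteresis that by (intro linked.hysteresis[of r \<epsilon> d s \<tau>]) auto
    then have "\<forall>\<^sub>F s in at_left t. linked r \<epsilon> d s"
      using hysteresis by (auto simp: eventually_at_left[of s t])
    then show ?thesis using hysteresis by auto
  qed (use assms in auto)
next
  assume R: ?R
  show ?L
  proof (cases "d t \<le> r - \<epsilon>")
    case True
    then show ?thesis using \<open>0 < t\<close> by (auto intro: linked.close)
  next
    case False
    have "isCont d t"
      using cont \<open>0 < t\<close> continuous_on_interior[of "{0..}" d t] by simp
    then have "\<forall>\<^sub>F s in at_left t. r - \<epsilon> < d s"
      using False by (intro order_tendstoD(1)[where y = "d t"])
        (auto simp: isCont_def filterlim_at_split)
    with R False have "\<forall>\<^sub>F s in at_left t. linked r \<epsilon> d s \<and> r - \<epsilon> < d s"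
      by (auto intro: eventually_conj)
    then obtain b where b: "b < t" "\<And>s. b < s \<Longrightarrow> s < t \<Longrightarrow> linked r \<epsilon> d s \<and> r - \<epsilon> < d s"
      using eventually_at_left[of "t - 1" t] by auto
    obtain s where s: "b < s" "s < t" using b(1) dense by blast
    have "r - \<epsilon> < d \<tau> \<and> d \<tau> \<le> r" if "\<tau> \<in> {s<..t}" for \<tau>
      using that b(2)[of \<tau>] s R False linked_le[OF \<open>0 < \<epsilon>\<close>, of r d \<tau>]
      by (cases "\<tau> = t") auto
    then show ?thesis using linked.hysteresis[of r \<epsilon> d s t] b(2)[of s] s by auto
  qed
qed

text \<open>
  The undirected graph \<open>G(t)\<close> is a symmetric digraph. As in the defining formula, the edge set
  contains the loops \<open>(i, i)\<close>; they affect neither connectivity nor the control law, in which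
  they contribute a zero summand.
\<close>

definition edges :: "nat \<Rightarrow> real \<Rightarrow> real \<Rightarrow> (nat \<Rightarrow> real \<Rightarrow> real^2) \<Rightarrow> real \<Rightarrow> (nat \<times> nat) set" where
  "edges N r \<epsilon> x t =
    {(i, j). i \<in> {1..N} \<and> j \<in> {1..N} \<and> linked r \<epsilon> (\<lambda>s. norm (x i s - x j s)) t}"

definition conn_graph ::
    "nat \<Rightarrow> real \<Rightarrow> real \<Rightarrow> (nat \<Rightarrow> real \<Rightarrow> real^2) \<Rightarrow> real \<Rightarrow> nat pair_pre_digraph" where
  "conn_graph N r \<epsilon> x t = \<lparr>pverts = {1..N}, parcs = edges N r \<epsilon> x t\<rparr>"

definition nbrs :: "nat \<Rightarrow> real \<Rightarrow> real \<Rightarrow> (nat \<Rightarrow> real \<Rightarrow> real^2) \<Rightarrow> real \<Rightarrow> nat \<Rightarrow> nat set" where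
  "nbrs N r \<epsilon> x t i = {j \<in> {1..N}. (i, j) \<in> edges N r \<epsilon> x t}"

text \<open>
  Solutions of \<open>x' = u\<close> from time 0 on are taken in the integral (Caratheodory) sense, since
  \<open>u\<close> jumps whenever an edge appears and no classical solution exists there.
\<close>

definition single_integrator :: "(real \<Rightarrow> 'a::banach) \<Rightarrow> (real \<Rightarrow> 'a) \<Rightarrow> bool" where
  "single_integrator x u \<longleftrightarrow> (\<forall>t\<ge>0. (u has_integral (x t - x 0)) {0..t})"

lemma single_integrator_continuous:
  assumes "single_integrator x u"
  shows "continuous_on {0..} x"
proof -
  have "isCont x t" if "0 < t" for t
  proof -
    have "u integrable_on {0..t+1}"
      using assms that unfolding single_integrator_def by (intro has_integral_integrable[of _ "x (t + 1) - x 0"]) auto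
    then have "continuous_on {0..t+1} (\<lambda>s. x 0 + integral {0..s} u)"
      by (intro continuous_intros indefinite_integral_continuous_1)
    then have "continuous_on {0..t+1} x"
      by (rule continuous_on_eq) (use assms in \<open>auto simp: single_integrator_def integral_unique\<close>)
    then show ?thesis using that continuous_on_interior[of "{0..t+1}" x t] by simp
  qed
  moreover have "continuous (at 0 within {0..}) x"
  proof -
    have "u integrable_on {0..1}"
      using assms unfolding single_integrator_def by (intro has_integral_integrable[of _ "x 1 - x 0"]) auto
    then have "continuous_on {0..1} (\<lambda>s. x 0 + integral {0..s} u)"
      by (intro continuous_intros indefinite_integral_continuous_1)
    then have "continuous_on {0..1} x"
      by (rule continuous_on_eq) (use assms in \<open>auto simp: single_integrator_def integral_unique\<close>)
    then have "continuous (at 0 within {0..1}) x" by (auto simp: continuous_on_eq_continuous_within)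
    moreover have "at (0::real) within {0..1} = at 0 within {0..}"
      by (rule at_within_nhd[of _ "{..<1}"]) auto
    ultimately show ?thesis by (simp add: continuous_within)
  qed
  ultimately show ?thesis
    unfolding continuous_on_eq_continuous_within
    by (metis atLeast_iff continuous_at_imp_continuous_within order_le_less)
qed

lemma conn_graph_pseudo_graph: "pair_pseudo_graph (conn_graph N r \<epsilon> x t)"
proof unfold_locales
  show "finite (parcs (conn_graph N r \<epsilon> x t))"
    by (rule finite_subset[of _ "{1..N} \<times> {1..N}"]) (auto simp: conn_graph_def edges_def)
  show "symmetric (with_proj (conn_graph N r \<epsilon> x t))"
    by (auto simp: symmetric_def conn_graph_def edges_def norm_minus_commute intro!: symI)
qed (auto simp: conn_graph_def edges_def)

theorem edges_0_iff:
  "(i, j) \<in> edges N r \<epsilon> x 0 \<longleftrightarrow> i \<in> {1..N} \<and> j \<in> {1..N} \<and> norm (x i 0 - x j 0) < r"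
  by (simp add: edges_def linked_0_iff)

theorem edges_iff:
  assumes "0 < \<epsilon>" "0 < t" "\<forall>i\<in>{1..N}. single_integrator (x i) (u i)"
    and "i \<in> {1..N}" "j \<in> {1..N}"
  shows "(i, j) \<in> edges N r \<epsilon> x t \<longleftrightarrow>
    norm (x i t - x j t) \<le> r - \<epsilon> \<or>
    (r - \<epsilon> < norm (x i t - x j t) \<and> norm (x i t - x j t) \<le> r \<and>
      (\<forall>\<^sub>F s in at_left t. (i, j) \<in> edges N r \<epsilon> x s))"
proof -
  have "continuous_on {0..} (\<lambda>s. norm (x i s - x j s))"
    using assms by (intro continuous_intros single_integrator_continuous) auto
  from linked_iff_left_limit[OF assms(1,2) this, of r] show ?thesis
    using assms(4,5) by (simp add: edges_def)
qed

end

(*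
  The controller is the negative gradient of the sum of the leader's goal potential and the
  interaction potentials of the present links, so this energy decreases between switching times.
  Hysteresis makes a new link appear only at distance at most r - \<epsilon>; charging every absent link
  the potential of that distance keeps the energy continuous when the link appears. Hence as long as
  all links are shorter than r, their potentials are bounded by the initial energy, which keeps
  their lengths below some r' < r. A link can only be lost by reaching length r, so no link is ever
  lost.
*)

theory Submission
  imports Defs
begin

section \<open>Links along a continuous distance\<close>

text \<open>At the last time \<open>\<sigma>\<close> with
  \<open>d \<sigma> \<le> r - \<epsilon>\<close> the link is present by closeness; afterwards the
  distance lies in the band, where \<open>hysteresis\<close> keeps the link. Without such a time
  \<open>hysteresis\<close> applies from \<open>s\<close> directly.\<close>

lemma linked_persist:
  assumes "0 < \<epsilon>" and cont: "continuous_on {0..} d" and s: "linked r \<epsilon> d s" "s \<le> t"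
    and le: "\<And>\<tau>. \<tau> \<in> {s..t} \<Longrightarrow> d \<tau> \<le> r"
  shows "linked r \<epsilon> d t"
proof (cases "\<exists>\<tau>\<in>{s..t}. d \<tau> \<le> r - \<epsilon>")
  case False
  then show ?thesis
    using s le linked.hysteresis[of r \<epsilon> d s t] by (cases "s = t") (auto simp: not_le)
next
  case True
  define K where "K = {\<tau> \<in> {s..t}. d \<tau> \<le> r - \<epsilon>}"
  have "0 \<le> s" using s(1) by (rule linked_nonneg)
  then have "continuous_on {s..t} d" by (intro continuous_on_subset[OF cont]) auto
  then have "closed K"
    unfolding K_def by (intro continuous_on_closed_Collect_le continuous_intros) auto
  moreover have "bounded K" unfolding K_def by (rule bounded_subset[of "{s..t}"]) auto
  moreover have "K \<noteq> {}" using True by (auto simp: K_def)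
  ultimately obtain \<sigma> where \<sigma>: "\<sigma> \<in> K" "\<And>\<tau>. \<tau> \<in> K \<Longrightarrow> \<tau> \<le> \<sigma>"
    using compact_attains_sup[of K] by (auto simp: compact_eq_bounded_closed)
  have "linked r \<epsilon> d \<sigma>"
    \<comment> \<open>Rule \<open>close\<close> needs a positive time; the case
      \<open>\<sigma> = s\<close> covers time 0.\<close>
    using \<sigma>(1) s \<open>0 \<le> s\<close> linked.close[of \<sigma> d r \<epsilon>] by (cases "\<sigma> = s") (auto simp: K_def)
  moreover have "r - \<epsilon> < d \<tau> \<and> d \<tau> \<le> r" if "\<tau> \<in> {\<sigma><..t}" for \<tau>
    using that \<sigma>(1) \<sigma>(2)[of \<tau>] le[of \<tau>] by (force simp: K_def)
  ultimately show ?thesis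
    using \<sigma>(1) linked.hysteresis[of r \<epsilon> d \<sigma> t] by (cases "\<sigma> = t") (auto simp: K_def)
qed

text \<open>A link can only start at time 0 or at distance at most \<open>r - \<epsilon>\<close>, so
  none starts inside \<open>{s<..t}\<close>; the induction traces the derivation back to
  \<open>s\<close>.\<close>

lemma linked_backward:
  assumes "linked r \<epsilon> d t" "0 \<le> s" "s \<le> t" "\<And>\<tau>. \<tau> \<in> {s<..t} \<Longrightarrow> r - \<epsilon> < d \<tau>"
  shows "linked r \<epsilon> d s"
  using assms
proof (induction rule: linked.induct)
  case initial
  then show ?case by (auto intro: linked.initial)
next
  case (close t)
  have "s = t"
  proof (rule ccontr)
    assume "s \<noteq> t"
    then have "r - \<epsilon> < d t" using close by auto
    with close show False by simp
  qed
  with close show ?case by (simp add: linked.close)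
next
  case (hysteresis s' t)
  show ?case
  proof (cases "s \<le> s'")
    case True
    with hysteresis show ?thesis by auto
  next
    case False
    with hysteresis show ?thesis by (intro linked.hysteresis[of r \<epsilon> d s' s]) auto
  qed
qed

lemma not_linked_less:
  assumes "0 < \<epsilon>" "0 \<le> t" "\<not> linked r \<epsilon> d t"
  shows "r - \<epsilon> < d t"
  using assms linked.close[of t d r \<epsilon>] linked_0_iff[of r \<epsilon> d] by (cases "t = 0") force+

lemma continuous_right_nhd:
  fixes d :: "real \<Rightarrow> real"
  assumes "continuous_on {0..} d" "0 \<le> t" "open U" "d t \<in> U"
  obtains e where "t < e" "\<And>\<tau>. \<tau> \<in> {t..<e} \<Longrightarrow> d \<tau> \<in> U"
proof -
  have "(d \<longlongrightarrow> d t) (at_right t)"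
    using assms(1,2) by (auto simp: continuous_on_def intro: tendsto_within_subset)
  then have "\<forall>\<^sub>F \<tau> in at_right t. d \<tau> \<in> U" using assms(3,4) by (rule topological_tendstoD)
  then obtain e where "t < e" "\<And>\<tau>. t < \<tau> \<Longrightarrow> \<tau> < e \<Longrightarrow> d \<tau> \<in> U"
    using eventually_at_right[of t "t + 1"] by auto
  then show ?thesis using that[of e] assms(4) by (metis atLeastLessThan_iff order_le_less)
qed

text \<open>By continuity the distance stays above \<open>r - \<epsilon>\<close> for a while, and a
  link in that range would already have been present at \<open>t\<close> by
  \<open>linked_backward\<close>.\<close>

lemma not_linked_right_nhd:
  assumes "0 < \<epsilon>" "continuous_on {0..} d" "0 \<le> t" "\<not> linked r \<epsilon> d t"
  obtains e where "t < e" "\<And>\<tau>. \<tau> \<in> {t..<e} \<Longrightarrow> \<not> linked r \<epsilon> d \<tau>"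
proof -
  obtain e where e: "t < e" "\<And>\<tau>. \<tau> \<in> {t..<e} \<Longrightarrow> d \<tau> \<in> {r - \<epsilon><..}"
    using continuous_right_nhd[OF assms(2,3), of "{r - \<epsilon><..}"] not_linked_less[OF assms(1,3,4)] by auto
  show ?thesis
  proof (rule that[OF e(1)])
    fix \<tau> assume \<tau>: "\<tau> \<in> {t..<e}"
    show "\<not> linked r \<epsilon> d \<tau>"
    proof
      assume "linked r \<epsilon> d \<tau>"
      then have "linked r \<epsilon> d t"
        using assms(3) \<tau> e(2) by (intro linked_backward[of r \<epsilon> d \<tau> t]) auto
      with assms(4) show False by simp
    qed
  qed
qed

text \<open>Definedness of one interaction term persists for a short time: an absent link stays
  absent even if the distance is at least \<open>r\<close>, and a present one stays shorter than
  \<open>r\<close> by continuity.\<close>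

lemma link_distance_right_nhd:
  assumes "0 < \<epsilon>" "continuous_on {0..} d" "0 \<le> t" "linked r \<epsilon> d t \<Longrightarrow> d t < r"
  obtains e where "t < e" "\<And>\<tau>. \<tau> \<in> {t..<e} \<Longrightarrow> linked r \<epsilon> d \<tau> \<Longrightarrow> d \<tau> < r"
proof (cases "linked r \<epsilon> d t")
  case True
  then show ?thesis
    using continuous_right_nhd[OF assms(2,3), of "{..<r}"] assms(4) that by (metis lessThan_iff open_lessThan)
next
  case False
  then show ?thesis using not_linked_right_nhd[OF assms(1-3)] that by metis
qed

text \<open>The bound on the distance is available only while the link is present.
  \<open>linked_persist\<close> carries the link up to the first time at which the distance reaches
  \<open>r\<close>, and there it contradicts the bound.\<close>

lemma linked_mono:
  assumes "0 < \<epsilon>" and cont: "continuous_on {0..} d" and s: "linked r \<epsilon> d s" "s \<le> t"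
    and less: "\<And>\<tau>. \<tau> \<in> {s..t} \<Longrightarrow> linked r \<epsilon> d \<tau> \<Longrightarrow> d \<tau> < r"
  shows "linked r \<epsilon> d t"
proof (cases "\<exists>\<tau>\<in>{s..t}. r \<le> d \<tau>")
  case False
  then show ?thesis using assms(1,2) s by (intro linked_persist[of \<epsilon> d r s t]) (auto simp: not_le less_imp_le)
next
  case True
  define K where "K = {\<tau> \<in> {s..t}. r \<le> d \<tau>}"
  have "0 \<le> s" using s(1) by (rule linked_nonneg)
  then have cst: "continuous_on {s..t} d" by (intro continuous_on_subset[OF cont]) auto
  then have "closed K"
    unfolding K_def by (intro continuous_on_closed_Collect_le continuous_intros) auto
  moreover have "bounded K" unfolding K_def by (rule bounded_subset[of "{s..t}"]) auto
  moreover have "K \<noteq> {}" using True by (auto simp: K_def)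
  ultimately obtain \<sigma> where \<sigma>: "\<sigma> \<in> K" "\<And>\<tau>. \<tau> \<in> K \<Longrightarrow> \<sigma> \<le> \<tau>"
    using compact_attains_inf[of K] by (auto simp: compact_eq_bounded_closed)
  have "d s < r" using less[of s] s by simp
  \<comment> \<open>The intermediate value theorem gives \<open>d \<sigma> = r\<close>, so that
    \<open>d \<tau> \<le> r\<close> holds on the closed interval up to
    \<open>\<sigma>\<close>.\<close>
  then obtain \<sigma>' where \<sigma>': "s \<le> \<sigma>'" "\<sigma>' \<le> \<sigma>" "d \<sigma>' = r"
    using IVT'[of d s r \<sigma>] \<sigma>(1) continuous_on_subset[OF cst, of "{s..\<sigma>}"] by (auto simp: K_def)
  then have "\<sigma>' = \<sigma>" using \<sigma>(1) \<sigma>(2)[of \<sigma>'] by (force simp: K_def)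
  have "d \<tau> \<le> r" if "\<tau> \<in> {s..\<sigma>}" for \<tau>
    using that \<sigma>(1) \<sigma>(2)[of \<tau>] \<sigma>' \<open>\<sigma>' = \<sigma>\<close> by (force simp: K_def)
  then have "linked r \<epsilon> d \<sigma>"
    using assms(1) cont s(1) \<sigma>(1) by (intro linked_persist[of \<epsilon> d r s \<sigma>]) (auto simp: K_def)
  then have "d \<sigma> < r" using less[of \<sigma>] \<sigma>(1) by (simp add: K_def)
  then show ?thesis using \<sigma>' \<open>\<sigma>' = \<sigma>\<close> by simp
qed

text \<open>By \<open>linked_mono\<close> the link is never lost in \<open>{a..b}\<close>, so its
  status switches at most once. This leaves finitely many exceptional times for the energy, and the
  distance at the switch makes the potential continuous there.\<close>

lemma switch_time:
  assumes "0 < \<epsilon>" and cont: "continuous_on {0..} d" and "0 \<le> a"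
    and less: "\<And>\<tau>. \<tau> \<in> {a..b} \<Longrightarrow> linked r \<epsilon> d \<tau> \<Longrightarrow> d \<tau> < r"
  obtains \<sigma> where "a \<le> \<sigma>" "\<And>t. t \<in> {a..b} \<Longrightarrow> linked r \<epsilon> d t \<longleftrightarrow> \<sigma> \<le> t"
    "a < \<sigma> \<Longrightarrow> \<sigma> \<le> b \<Longrightarrow> d \<sigma> = r - \<epsilon>"
proof (cases "\<exists>t\<in>{a..b}. linked r \<epsilon> d t")
  case False
  \<comment> \<open>A time beyond \<open>b\<close> encodes that the link never appears;
    \<open>max\<close> keeps \<open>a \<le> \<sigma>\<close> when the interval is empty.\<close>
  then show ?thesis by (intro that[of "max a b + 1"]) auto
next
  case True
  define L where "L = {t \<in> {a..b}. linked r \<epsilon> d t}"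
  have L: "L \<noteq> {}" "bdd_below L" using True by (auto simp: L_def intro: bdd_belowI[of _ a])
  define \<sigma> where "\<sigma> = Inf L"
  have a\<sigma>: "a \<le> \<sigma>" unfolding \<sigma>_def using L(1) by (intro cInf_greatest) (auto simp: L_def)
  have \<sigma>_le: "\<sigma> \<le> t" if "t \<in> L" for t unfolding \<sigma>_def using that L(2) by (rule cInf_lower)
  then have \<sigma>b: "\<sigma> \<le> b" using L(1) by (force simp: L_def)
  \<comment> \<open>The infimum is attained: absence at \<open>\<sigma>\<close> would extend to the
    right and give a larger lower bound of \<open>L\<close>.\<close>
  have link\<sigma>: "linked r \<epsilon> d \<sigma>"
  proof (rule ccontr)
    assume "\<not> linked r \<epsilon> d \<sigma>"
    then obtain e where e: "\<sigma> < e" "\<And>\<tau>. \<tau> \<in> {\<sigma>..<e} \<Longrightarrow> \<not> linked r \<epsilon> d \<tau>"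
      using not_linked_right_nhd[of \<epsilon> d \<sigma> r] assms(1-3) a\<sigma> by auto
    have "e \<le> \<sigma>" unfolding \<sigma>_def
    proof (rule cInf_greatest[OF L(1)])
      fix t assume "t \<in> L"
      then show "e \<le> t" using e(2)[of t] \<sigma>_le[of t] by (force simp: L_def)
    qed
    with e(1) show False by simp
  qed
  show ?thesis
  proof (rule that[OF a\<sigma>])
    fix t assume t: "t \<in> {a..b}"
    show "linked r \<epsilon> d t \<longleftrightarrow> \<sigma> \<le> t"
    proof
      assume "linked r \<epsilon> d t" then show "\<sigma> \<le> t" using t \<sigma>_le by (auto simp: L_def)
    next
      assume "\<sigma> \<le> t"
      then show "linked r \<epsilon> d t"
        using assms(1) cont link\<sigma> less t a\<sigma> by (intro linked_mono[of \<epsilon> d r \<sigma> t]) auto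
    qed
  next
    assume "a < \<sigma>"
    have before: "\<not> linked r \<epsilon> d t" if "a \<le> t" "t < \<sigma>" for t
      using that \<sigma>_le[of t] \<sigma>b by (force simp: L_def)
    have "isCont d \<sigma>"
      using cont \<open>a < \<sigma>\<close> \<open>0 \<le> a\<close> continuous_on_interior[of "{0..}" d \<sigma>] by simp
    then have "(d \<longlongrightarrow> d \<sigma>) (at_left \<sigma>)" by (simp add: isCont_def filterlim_at_split)
    moreover have "\<forall>\<^sub>F t in at_left \<sigma>. r - \<epsilon> \<le> d t"
      using before not_linked_less[OF assms(1)] \<open>0 \<le> a\<close> \<open>a < \<sigma>\<close>
      by (force simp: eventually_at_left[of a \<sigma>] intro: exI[of _ a] less_imp_le)
    ultimately have "r - \<epsilon> \<le> d \<sigma>" by (rule tendsto_lowerbound) simp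
    \<comment> \<open>Only \<open>close\<close> can create the link at \<open>\<sigma>\<close>:
      \<open>hysteresis\<close> would place it shortly before \<open>\<sigma>\<close> as well, and
      \<open>initial\<close> requires time 0.\<close>
    moreover have "d \<sigma> \<le> r - \<epsilon>"
      using link\<sigma>
    proof cases
      case (hysteresis s)
      obtain t where t: "max a s < t" "t < \<sigma>"
        using dense[of "max a s" \<sigma>] hysteresis \<open>a < \<sigma>\<close> by auto
      then have "linked r \<epsilon> d t" using hysteresis by (intro linked.hysteresis[of r \<epsilon> d s t]) auto
      with before[of t] t show ?thesis by simp
    qed (use \<open>a < \<sigma>\<close> \<open>0 \<le> a\<close> in auto)
    ultimately show "d \<sigma> = r - \<epsilon>" by simp
  qed
qed


section \<open>The energy\<close>

text \<open>
  An absent link is charged the constant potential of the distance \<open>r - \<epsilon>\<close> at which it would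
  emerge. This makes the potential continuous across switching times.
\<close>

definition link_potential :: "real \<Rightarrow> real \<Rightarrow> (real \<Rightarrow> real) \<Rightarrow> real \<Rightarrow> real" where
  "link_potential r \<epsilon> d t =
    (if linked r \<epsilon> d t then (d t)\<^sup>2 / (r\<^sup>2 - (d t)\<^sup>2) else (r - \<epsilon>)\<^sup>2 / (r\<^sup>2 - (r - \<epsilon>)\<^sup>2))"

lemma link_potential_nonneg:
  assumes "0 < \<epsilon>" "\<epsilon> < r" "0 \<le> d t" "linked r \<epsilon> d t \<Longrightarrow> d t < r"
  shows "0 \<le> link_potential r \<epsilon> d t"
  using assms by (auto simp: link_potential_def intro!: divide_nonneg_nonneg power_mono)

text \<open>The only critical time is a switch \<open>\<sigma>\<close> after \<open>a\<close>; there
  the distance is \<open>r - \<epsilon>\<close>, whose potential is the charge of the absent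
  link.\<close>

lemma link_potential_continuous:
  assumes "0 < \<epsilon>" "\<epsilon> < r" and cont: "continuous_on {0..} d" and "0 \<le> a" and nonneg: "\<And>t. 0 \<le> d t"
    and less: "\<And>\<tau>. \<tau> \<in> {a..b} \<Longrightarrow> linked r \<epsilon> d \<tau> \<Longrightarrow> d \<tau> < r"
  shows "continuous_on {a..b} (link_potential r \<epsilon> d)"
proof -
  obtain \<sigma> where \<sigma>: "a \<le> \<sigma>" "\<And>t. t \<in> {a..b} \<Longrightarrow> linked r \<epsilon> d t \<longleftrightarrow> \<sigma> \<le> t"
    "a < \<sigma> \<Longrightarrow> \<sigma> \<le> b \<Longrightarrow> d \<sigma> = r - \<epsilon>"
    using switch_time[OF assms(1) cont \<open>0 \<le> a\<close> less] by blast
  show ?thesis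
  proof (cases "\<sigma> \<le> b")
    case True
    \<comment> \<open>\<open>max t \<sigma>\<close> freezes the distance at
      \<open>d \<sigma>\<close> before the switch, so one formula covers both phases.\<close>
    have "continuous_on {a..b} (\<lambda>t. d (max t \<sigma>))"
      using \<sigma>(1) \<open>0 \<le> a\<close> by (intro continuous_on_compose2[OF cont] continuous_intros) auto
    moreover have "r\<^sup>2 - (d (max t \<sigma>))\<^sup>2 \<noteq> 0" if "t \<in> {a..b}" for t
    proof -
      have "max t \<sigma> \<in> {a..b}" using that True by auto
      then have "d (max t \<sigma>) < r" using \<sigma>(2) less by simp
      then show ?thesis using power_strict_mono[of "d (max t \<sigma>)" r 2] nonneg by simp
    qed
    ultimately have "continuous_on {a..b} (\<lambda>t. (d (max t \<sigma>))\<^sup>2 / (r\<^sup>2 - (d (max t \<sigma>))\<^sup>2))"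
      by (intro continuous_intros) auto
    then show ?thesis
      by (rule continuous_on_eq) (use \<sigma> True in \<open>auto simp: link_potential_def max_def\<close>)
  next
    case False
    then show ?thesis
      by (intro continuous_on_eq[OF continuous_on_const[of _ "(r - \<epsilon>)\<^sup>2 / (r\<^sup>2 - (r - \<epsilon>)\<^sup>2)"]])
        (use \<sigma> in \<open>auto simp: link_potential_def\<close>)
  qed
qed

text \<open>Chain rule: the vector paired with \<open>v'\<close> is the gradient of the potential,
  which is the summand of the control law.\<close>

lemma interaction_potential_derivative:
  fixes v :: "real \<Rightarrow> 'a::real_inner"
  assumes "(v has_vector_derivative v') (at t)" "norm (v t) < r"
  shows "((\<lambda>s. (norm (v s))\<^sup>2 / (r\<^sup>2 - (norm (v s))\<^sup>2)) has_real_derivative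
    ((2 * r\<^sup>2 / (r\<^sup>2 - (norm (v t))\<^sup>2)\<^sup>2) *\<^sub>R v t) \<bullet> v') (at t)"
proof -
  have nz: "r\<^sup>2 - v t \<bullet> v t \<noteq> 0"
    using power_strict_mono[of "norm (v t)" r 2] assms(2) by (simp add: power2_norm_eq_inner)
  have der: "((\<lambda>s. v s \<bullet> v s) has_real_derivative 2 * (v t \<bullet> v')) (at t)"
    using has_derivative_inner[OF assms(1)[unfolded has_vector_derivative_def] assms(1)[unfolded has_vector_derivative_def]]
    unfolding has_field_derivative_def
    by (rule has_derivative_eq_rhs) (auto simp: fun_eq_iff inner_commute)
  show ?thesis
    unfolding power2_norm_eq_inner
    by (rule DERIV_cong[OF DERIV_divide[OF der DERIV_diff[OF DERIV_const der] nz]])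
      (simp add: algebra_simps power2_eq_square)
qed

text \<open>Where the input is continuous, the fundamental theorem of calculus turns the integral
  form of the dynamics into a classical derivative.\<close>

lemma single_integrator_has_vector_derivative:
  assumes "single_integrator x u" "0 < t" "isCont u t"
  shows "(x has_vector_derivative u t) (at t)"
proof -
  have int: "(u has_integral x s - x 0) {0..s}" if "0 \<le> s" for s
    using assms(1) that by (auto simp: single_integrator_def)
  have "((\<lambda>s. integral {0..s} u) has_vector_derivative u t) (at t within ({0..t + 1} - {}))"
    using assms(2,3) int[of "t + 1"]
    by (intro integral_has_vector_derivative_continuous_at) (auto intro: continuous_at_imp_continuous_within)
  then have "((\<lambda>s. x 0 + integral {0..s} u) has_vector_derivative u t) (at t)"
    using assms(2) at_within_interior[of t "{0..t + 1}"]
    by (auto intro!: derivative_eq_intros)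
  then show ?thesis
    by (rule has_vector_derivative_transform_within_open[of _ _ _ "{0<..}"])
      (use assms(2) int[THEN integral_unique] in auto)
qed

text \<open>Exchanging the indices turns the \<open>u j\<close> half of the sum into the
  \<open>u i\<close> half. With \<open>g\<close> the pairwise attraction this collects the
  derivatives of all link potentials agent by agent.\<close>

lemma sum_antisymmetric_inner:
  fixes g :: "'i \<Rightarrow> 'i \<Rightarrow> 'a::real_inner"
  assumes "\<And>i j. i \<in> A \<Longrightarrow> j \<in> A \<Longrightarrow> g j i = - g i j"
  shows "(\<Sum>i\<in>A. \<Sum>j\<in>A. g i j \<bullet> (u i - u j)) = 2 * (\<Sum>i\<in>A. (\<Sum>j\<in>A. g i j) \<bullet> u i)"
proof -
  have "(\<Sum>i\<in>A. \<Sum>j\<in>A. g i j \<bullet> u j) = (\<Sum>i\<in>A. \<Sum>j\<in>A. g j i \<bullet> u i)" by (rule sum.swap)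
  also have "\<dots> = (\<Sum>i\<in>A. \<Sum>j\<in>A. - (g i j \<bullet> u i))"
    using assms by (intro sum.cong refl) (metis inner_minus_left)
  finally have "(\<Sum>i\<in>A. \<Sum>j\<in>A. g i j \<bullet> u j) = - (\<Sum>i\<in>A. \<Sum>j\<in>A. g i j \<bullet> u i)"
    by (simp add: sum_negf)
  then show ?thesis by (simp add: inner_diff_right sum_subtractf inner_sum_left)
qed

section \<open>The controlled network and the decay of its energy\<close>

locale controlled_network =
  fixes N :: nat and r \<epsilon> T :: real and x u :: "nat \<Rightarrow> real \<Rightarrow> real^2"
    and b :: "nat \<Rightarrow> real" and c :: "nat \<Rightarrow> real^2"
  assumes eps: "0 < \<epsilon>" "\<epsilon> < r" and T_nonneg: "0 \<le> T"
    and dynamics: "\<And>i. i \<in> {1..N} \<Longrightarrow> single_integrator (x i) (u i)"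
    and controller: "\<And>i t. i \<in> {1..N} \<Longrightarrow> T \<le> t \<Longrightarrow>
      u i t = - b i *\<^sub>R (x i t - c i)
        - (\<Sum>j\<in>nbrs N r \<epsilon> x t i.
            (2 * r\<^sup>2 / (r\<^sup>2 - (norm (x i t - x j t))\<^sup>2)\<^sup>2) *\<^sub>R (x i t - x j t))"
    and b_nonneg: "\<And>i. i \<in> {1..N} \<Longrightarrow> 0 \<le> b i"
begin

abbreviation distance :: "nat \<Rightarrow> nat \<Rightarrow> real \<Rightarrow> real" where
  "distance i j \<equiv> (\<lambda>t. norm (x i t - x j t))"

text \<open>A link may have length exactly \<open>r\<close>, where the potential is undefined and
  the control law would contain a division by zero, which HOL evaluates to 0. This predicate
  excludes such times.\<close>

definition controller_defined :: "real \<Rightarrow> bool" where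
  "controller_defined t \<longleftrightarrow>
    (\<forall>i\<in>{1..N}. \<forall>j\<in>{1..N}. linked r \<epsilon> (distance i j) t \<longrightarrow> distance i j t < r)"

text \<open>Extending the summand by 0 replaces the time-varying neighbour sums by sums over the
  fixed set \<open>{1..N}\<close>.\<close>

definition attraction :: "nat \<Rightarrow> nat \<Rightarrow> real \<Rightarrow> real^2" where
  "attraction i j t = (if linked r \<epsilon> (distance i j) t
    then (2 * r\<^sup>2 / (r\<^sup>2 - (distance i j t)\<^sup>2)\<^sup>2) *\<^sub>R (x i t - x j t) else 0)"

text \<open>The double sum counts every pair twice, hence its factor 1/2; the other 1/2 makes
  \<open>b i *\<^sub>R (x i t - c i)\<close> the gradient of the goal term.\<close>

definition energy :: "real \<Rightarrow> real" where
  "energy t = (\<Sum>i\<in>{1..N}. b i * (norm (x i t - c i))\<^sup>2 / 2)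
    + (\<Sum>i\<in>{1..N}. \<Sum>j\<in>{1..N}. link_potential r \<epsilon> (distance i j) t) / 2"

lemma position_continuous: "i \<in> {1..N} \<Longrightarrow> continuous_on {0..} (x i)"
  using dynamics by (rule single_integrator_continuous)

lemma distance_continuous:
  "i \<in> {1..N} \<Longrightarrow> j \<in> {1..N} \<Longrightarrow> continuous_on {0..} (distance i j)"
  by (intro continuous_intros position_continuous)

lemma input_eq:
  assumes "i \<in> {1..N}" "T \<le> t"
  shows "u i t = - b i *\<^sub>R (x i t - c i) - (\<Sum>j\<in>{1..N}. attraction i j t)"
proof -
  have "nbrs N r \<epsilon> x t i = {j \<in> {1..N}. linked r \<epsilon> (distance i j) t}"
    using assms(1) by (auto simp: nbrs_def edges_def)
  then show ?thesis
    unfolding controller[OF assms] attraction_def by (simp only: sum.inter_filter finite_atLeastAtMost)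
qed

lemma attraction_antisymmetric: "attraction j i t = - attraction i j t"
proof -
  have "linked r \<epsilon> (distance j i) t = linked r \<epsilon> (distance i j) t"
    by (simp add: norm_minus_commute)
  then show ?thesis
    unfolding attraction_def norm_minus_commute[of "x j t" "x i t"] by (simp flip: scaleR_minus_right)
qed

text \<open>Between switches \<open>u i\<close> is the negative gradient of the energy with respect
  to \<open>x i\<close>, so the derivative of the energy is minus the sum of the squared input
  norms. Continuity bridges the finitely many switches.\<close>

lemma energy_decreasing:
  assumes "T \<le> a" "a \<le> e" and defined: "\<And>t. t \<in> {a..e} \<Longrightarrow> controller_defined t"
  shows "energy e \<le> energy a"
proof -
  have less: "distance i j t < r"
    if "i \<in> {1..N}" "j \<in> {1..N}" "t \<in> {a..e}" "linked r \<epsilon> (distance i j) t" for i j t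
    using defined that by (auto simp: controller_defined_def)
  have "0 \<le> a" using assms(1) T_nonneg by simp
  have "\<exists>\<sigma>. \<forall>t\<in>{a..e}. linked r \<epsilon> (distance i j) t \<longleftrightarrow> \<sigma> \<le> t"
    if ij: "i \<in> {1..N}" "j \<in> {1..N}" for i j
  proof (rule switch_time[OF eps(1) distance_continuous[OF ij] \<open>0 \<le> a\<close> less[OF ij]])
    fix \<sigma>
    assume "\<And>t. t \<in> {a..e} \<Longrightarrow> linked r \<epsilon> (distance i j) t \<longleftrightarrow> \<sigma> \<le> t"
    then show ?thesis by (intro exI[of _ \<sigma>] ballI)
  qed
  then obtain \<sigma> where \<sigma>: "\<And>i j t. i \<in> {1..N} \<Longrightarrow> j \<in> {1..N} \<Longrightarrow> t \<in> {a..e} \<Longrightarrow>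
      linked r \<epsilon> (distance i j) t \<longleftrightarrow> \<sigma> i j \<le> t"
    by metis
  define S where "S = (\<lambda>(i, j). \<sigma> i j) ` ({1..N} \<times> {1..N})"
  have "finite S" by (simp add: S_def)
  have cont: "continuous_on {a..e} energy"
    unfolding energy_def using eps \<open>0 \<le> a\<close> less
    by (intro continuous_intros link_potential_continuous distance_continuous
        continuous_on_subset[OF position_continuous]) auto
  have der: "(energy has_vector_derivative - (\<Sum>i\<in>{1..N}. (norm (u i t))\<^sup>2)) (at t)"
    if t: "t \<in> {a<..<e} - S" for t
  proof -
    have "0 < t" "T \<le> t" "t \<in> {a..e}" using t \<open>0 \<le> a\<close> assms(1) by auto
    have isCont_x: "isCont (x i) t" if "i \<in> {1..N}" for i
      using position_continuous[OF that] \<open>0 < t\<close> continuous_on_interior[of "{0..}" "x i" t] by simp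
    \<comment> \<open>Off \<open>S\<close> the link status is locally constant, so near
      \<open>t\<close> each case distinction reduces to one smooth branch.\<close>
    have ev: "\<forall>\<^sub>F s in nhds t. linked r \<epsilon> (distance i j) s \<longleftrightarrow> linked r \<epsilon> (distance i j) t"
      if ij: "i \<in> {1..N}" "j \<in> {1..N}" for i j
    proof -
      have "\<sigma> i j \<noteq> t" using t ij by (auto simp: S_def)
      then have "\<forall>\<^sub>F s in nhds t. \<sigma> i j \<le> s \<longleftrightarrow> \<sigma> i j \<le> t"
      proof (cases "\<sigma> i j \<le> t")
        case True
        then have "t \<in> {\<sigma> i j<..}" using \<open>\<sigma> i j \<noteq> t\<close> by simp
        then show ?thesis
          using True eventually_nhds_in_open[of "{\<sigma> i j<..}" t] by (auto elim!: eventually_mono)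
      next
        case False
        then show ?thesis
          using eventually_nhds_in_open[of "{..<\<sigma> i j}" t] by (auto elim!: eventually_mono)
      qed
      moreover have "\<forall>\<^sub>F s in nhds t. s \<in> {a<..<e}"
        using t by (intro eventually_nhds_in_open) auto
      ultimately show ?thesis
        by eventually_elim (use \<sigma>[OF ij] \<open>t \<in> {a..e}\<close> in auto)
    qed
    have isCont_attraction: "isCont (attraction i j) t" if ij: "i \<in> {1..N}" "j \<in> {1..N}" for i j
    proof (cases "linked r \<epsilon> (distance i j) t")
      case True
      then have "distance i j t < r" using less[OF ij \<open>t \<in> {a..e}\<close>] by simp
      then have "r\<^sup>2 - (distance i j t)\<^sup>2 \<noteq> 0"
        using power_strict_mono[of "distance i j t" r 2] by simp
      then have "isCont (\<lambda>s. (2 * r\<^sup>2 / (r\<^sup>2 - (distance i j s)\<^sup>2)\<^sup>2) *\<^sub>R (x i s - x j s)) t"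
        by (intro continuous_intros isCont_x ij) simp
      moreover have "\<forall>\<^sub>F s in nhds t. attraction i j s
          = (2 * r\<^sup>2 / (r\<^sup>2 - (distance i j s)\<^sup>2)\<^sup>2) *\<^sub>R (x i s - x j s)"
        using ev[OF ij] by eventually_elim (simp add: attraction_def True)
      ultimately show ?thesis by (simp add: isCont_cong)
    next
      case False
      have "\<forall>\<^sub>F s in nhds t. attraction i j s = 0"
        using ev[OF ij] by eventually_elim (simp add: attraction_def False)
      then show ?thesis by (simp add: isCont_cong)
    qed
    \<comment> \<open>The control law is continuous off \<open>S\<close>, so the trajectories are
      classically differentiable there.\<close>
    have der_x: "(x i has_vector_derivative u i t) (at t)" if i: "i \<in> {1..N}" for i
    proof -
      have "isCont (\<lambda>s. - b i *\<^sub>R (x i s - c i) - (\<Sum>j\<in>{1..N}. attraction i j s)) t"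
        by (intro continuous_intros isCont_x isCont_attraction i)
      moreover have "\<forall>\<^sub>F s in nhds t. u i s
          = - b i *\<^sub>R (x i s - c i) - (\<Sum>j\<in>{1..N}. attraction i j s)"
      proof (rule eventually_mono)
        show "\<forall>\<^sub>F s in nhds t. s \<in> {a<..}" using t by (intro eventually_nhds_in_open) auto
      qed (use assms(1) in \<open>simp add: input_eq[OF i]\<close>)
      ultimately have "isCont (u i) t" by (simp add: isCont_cong)
      with dynamics[OF i] \<open>0 < t\<close> show ?thesis by (rule single_integrator_has_vector_derivative)
    qed
    have der_link: "(link_potential r \<epsilon> (distance i j) has_real_derivative
        attraction i j t \<bullet> (u i t - u j t)) (at t)" if ij: "i \<in> {1..N}" "j \<in> {1..N}" for i j
    proof (cases "linked r \<epsilon> (distance i j) t")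
      case True
      have "((\<lambda>s. (distance i j s)\<^sup>2 / (r\<^sup>2 - (distance i j s)\<^sup>2)) has_real_derivative
          attraction i j t \<bullet> (u i t - u j t)) (at t)"
        using interaction_potential_derivative[OF has_vector_derivative_diff[OF der_x[OF ij(1)] der_x[OF ij(2)]]
            less[OF ij \<open>t \<in> {a..e}\<close> True]] True
        by (simp add: attraction_def)
      moreover have "\<forall>\<^sub>F s in nhds t. link_potential r \<epsilon> (distance i j) s
          = (distance i j s)\<^sup>2 / (r\<^sup>2 - (distance i j s)\<^sup>2)"
        using ev[OF ij] by eventually_elim (simp add: link_potential_def True)
      ultimately show ?thesis by (subst DERIV_cong_ev[OF refl _ refl])
    next
      case False
      have "\<forall>\<^sub>F s in nhds t. link_potential r \<epsilon> (distance i j) s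
          = (r - \<epsilon>)\<^sup>2 / (r\<^sup>2 - (r - \<epsilon>)\<^sup>2)"
        using ev[OF ij] by eventually_elim (simp add: link_potential_def False)
      from DERIV_cong_ev[OF refl this refl] show ?thesis by (simp add: attraction_def False)
    qed
    have der_goal: "((\<lambda>s. b i * (norm (x i s - c i))\<^sup>2 / 2) has_real_derivative
        (b i *\<^sub>R (x i t - c i)) \<bullet> u i t) (at t)" if i: "i \<in> {1..N}" for i
    proof -
      have "((\<lambda>s. x i s - c i) has_derivative (\<lambda>h. h *\<^sub>R u i t)) (at t)"
        using has_vector_derivative_diff_const[of "x i" "c i" "u i t" "at t"] der_x[OF i]
        by (simp add: has_vector_derivative_def)
      from has_derivative_inner[OF this this]
      have "((\<lambda>s. (x i s - c i) \<bullet> (x i s - c i)) has_real_derivative 2 * ((x i t - c i) \<bullet> u i t)) (at t)"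
        unfolding has_field_derivative_def
        by (rule has_derivative_eq_rhs) (auto simp: fun_eq_iff inner_commute)
      from DERIV_cmult[OF this, of "b i / 2"] show ?thesis
        by (simp add: power2_norm_eq_inner)
    qed
    have "(energy has_real_derivative
        (\<Sum>i\<in>{1..N}. (b i *\<^sub>R (x i t - c i)) \<bullet> u i t)
        + (\<Sum>i\<in>{1..N}. \<Sum>j\<in>{1..N}. attraction i j t \<bullet> (u i t - u j t)) / 2) (at t)"
      unfolding energy_def[abs_def] by (intro DERIV_add DERIV_sum DERIV_cdivide der_goal der_link)
    \<comment> \<open>Antisymmetry of the attraction cancels the factor 1/2.\<close>
    also have "(\<Sum>i\<in>{1..N}. \<Sum>j\<in>{1..N}. attraction i j t \<bullet> (u i t - u j t)) / 2
        = (\<Sum>i\<in>{1..N}. (\<Sum>j\<in>{1..N}. attraction i j t) \<bullet> u i t)"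
      by (subst sum_antisymmetric_inner) (auto intro: attraction_antisymmetric)
    \<comment> \<open>By \<open>input_eq\<close> the gradient with respect to \<open>x i\<close> is
      \<open>- u i t\<close>.\<close>
    also have "(\<Sum>i\<in>{1..N}. (b i *\<^sub>R (x i t - c i)) \<bullet> u i t) + \<dots> = - (\<Sum>i\<in>{1..N}. (norm (u i t))\<^sup>2)"
      unfolding sum.distrib[symmetric] sum_negf[of _ "{1..N}", symmetric]
    proof (rule sum.cong[OF refl])
      fix i assume "i \<in> {1..N}"
      then have "b i *\<^sub>R (x i t - c i) + (\<Sum>j\<in>{1..N}. attraction i j t) = - u i t"
        using input_eq \<open>T \<le> t\<close> by simp
      then have "(b i *\<^sub>R (x i t - c i) + (\<Sum>j\<in>{1..N}. attraction i j t)) \<bullet> u i t = - (norm (u i t))\<^sup>2"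
        by (simp add: power2_norm_eq_inner)
      then show "(b i *\<^sub>R (x i t - c i)) \<bullet> u i t + (\<Sum>j\<in>{1..N}. attraction i j t) \<bullet> u i t
          = - (norm (u i t))\<^sup>2"
        by (simp add: inner_add_left)
    qed
    finally show ?thesis by (simp add: has_real_derivative_iff_has_vector_derivative)
  qed
  have "((\<lambda>t. - (\<Sum>i\<in>{1..N}. (norm (u i t))\<^sup>2)) has_integral energy e - energy a) {a..e}"
    using \<open>finite S\<close> \<open>a \<le> e\<close> der cont by (rule fundamental_theorem_of_calculus_interior_strong)
  then have "energy e - energy a \<le> 0"
    using has_integral_0 by (rule has_integral_le) (simp add: sum_nonneg)
  then show ?thesis by simp
qed

section \<open>Uniform bound on the link lengths and continuation in time\<close>

lemma linked_distance_bound: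
  assumes "controller_defined t" "i \<in> {1..N}" "j \<in> {1..N}" "linked r \<epsilon> (distance i j) t"
  shows "(distance i j t)\<^sup>2 * (1 + 2 * energy t) \<le> r\<^sup>2 * (2 * energy t)" "0 \<le> energy t"
proof -
  have lp: "0 \<le> link_potential r \<epsilon> (distance i j) t" if "i \<in> {1..N}" "j \<in> {1..N}" for i j
    using assms(1) that by (intro link_potential_nonneg eps) (auto simp: controller_defined_def)
  have goal: "0 \<le> (\<Sum>i\<in>{1..N}. b i * (norm (x i t - c i))\<^sup>2 / 2)"
    using b_nonneg by (intro sum_nonneg) simp
  \<comment> \<open>All summands of the energy are nonnegative, the goal terms because of
    \<open>b_nonneg\<close>, so a single link potential is at most twice the energy.\<close>
  have "link_potential r \<epsilon> (distance i j) t \<le> (\<Sum>j\<in>{1..N}. link_potential r \<epsilon> (distance i j) t)"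
    using assms lp by (intro member_le_sum) auto
  also have "\<dots> \<le> (\<Sum>i\<in>{1..N}. \<Sum>j\<in>{1..N}. link_potential r \<epsilon> (distance i j) t)"
    using assms lp by (intro member_le_sum[where f = "\<lambda>i. \<Sum>j\<in>{1..N}. link_potential r \<epsilon> (distance i j) t"] sum_nonneg) auto
  also have "\<dots> \<le> 2 * energy t" using goal by (simp add: energy_def)
  finally have le: "link_potential r \<epsilon> (distance i j) t \<le> 2 * energy t" .
  then show "0 \<le> energy t" using lp[OF assms(2,3)] by simp
  have "distance i j t < r" using assms by (auto simp: controller_defined_def)
  then have "0 < r\<^sup>2 - (distance i j t)\<^sup>2"
    using power_strict_mono[of "distance i j t" r 2] by simp
  with le assms(4) have "(distance i j t)\<^sup>2 \<le> 2 * energy t * (r\<^sup>2 - (distance i j t)\<^sup>2)"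
    by (simp add: link_potential_def pos_divide_le_eq)
  then show "(distance i j t)\<^sup>2 * (1 + 2 * energy t) \<le> r\<^sup>2 * (2 * energy t)"
    by (simp add: algebra_simps)
qed

text \<open>Continuation argument at the infimum \<open>T'\<close> of the failure times. Before
  \<open>T'\<close> the decaying energy keeps all links no longer than some \<open>r' < r\<close>;
  hence the links at \<open>T'\<close> are shorter than \<open>r\<close>, and definedness extends
  beyond \<open>T'\<close>, a contradiction.\<close>

lemma controller_defined_always:
  assumes "controller_defined T" "T \<le> t"
  shows "controller_defined t"
proof (rule ccontr)
  assume "\<not> controller_defined t"
  define B where "B = {t. T \<le> t \<and> \<not> controller_defined t}"
  have B: "B \<noteq> {}" "bdd_below B"
    using assms(2) \<open>\<not> controller_defined t\<close> by (auto simp: B_def intro: bdd_belowI[of _ T])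
  define T' where "T' = Inf B"
  have "T \<le> T'" unfolding T'_def using B(1) by (intro cInf_greatest) (auto simp: B_def)
  then have "0 \<le> T'" using T_nonneg by simp
  have before: "controller_defined s" if "T \<le> s" "s < T'" for s
    using that cInf_lower[OF _ B(2), of s] by (force simp: B_def T'_def)
  \<comment> \<open>\<open>r'\<close> is the distance whose potential equals
    \<open>2 * energy T\<close>; it does not depend on time.\<close>
  define r' where "r' = sqrt (r\<^sup>2 * (2 * energy T) / (1 + 2 * energy T))"
  \<comment> \<open>\<open>r' < r\<close> belongs to the conclusion because
    \<open>0 \<le> energy T\<close> is derived here from the presence of a link.\<close>
  have bound: "distance i j s \<le> r' \<and> r' < r"
    if s: "T \<le> s" "s < T'" and ij: "i \<in> {1..N}" "j \<in> {1..N}" and link: "linked r \<epsilon> (distance i j) s" for i j s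
  proof -
    have "energy s \<le> energy T" using s before by (intro energy_decreasing) auto
    moreover have dist: "(distance i j s)\<^sup>2 * (1 + 2 * energy s) \<le> r\<^sup>2 * (2 * energy s)" "0 \<le> energy s"
      using linked_distance_bound[OF before[OF s] ij link] by auto
    moreover have "(distance i j s)\<^sup>2 \<le> r\<^sup>2"
      using before[OF s] ij link by (intro power_mono) (auto simp: controller_defined_def less_imp_le)
    \<comment> \<open>Adding this inequality to the first one in \<open>dist\<close> replaces
      \<open>energy s\<close> by \<open>energy T\<close>.\<close>
    then have "(distance i j s)\<^sup>2 * (2 * (energy T - energy s)) \<le> r\<^sup>2 * (2 * (energy T - energy s))"
      using \<open>energy s \<le> energy T\<close> by (intro mult_right_mono) auto
    ultimately have "(distance i j s)\<^sup>2 * (1 + 2 * energy T) \<le> r\<^sup>2 * (2 * energy T)" and E: "0 \<le> energy T"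
      by (auto simp: algebra_simps)
    then have "(distance i j s)\<^sup>2 \<le> r\<^sup>2 * (2 * energy T) / (1 + 2 * energy T)"
      by (simp add: pos_le_divide_eq)
    then have "distance i j s \<le> r'" unfolding r'_def by (rule real_le_rsqrt)
    moreover have "r' < r"
    proof -
      have "r\<^sup>2 * (2 * energy T) / (1 + 2 * energy T) < r\<^sup>2"
        using E eps by (simp add: pos_divide_less_eq algebra_simps)
      then show ?thesis unfolding r'_def using eps by (intro real_less_lsqrt) auto
    qed
    ultimately show ?thesis by simp
  qed
  have defined_T': "controller_defined T'"
  proof (cases "T = T'")
    case True with assms(1) show ?thesis by simp
  next
    case False
    then have "T < T'" using \<open>T \<le> T'\<close> by simp
    then have "0 < T'" using T_nonneg by simp
    have "distance i j T' < r"
      if ij: "i \<in> {1..N}" "j \<in> {1..N}" and link: "linked r \<epsilon> (distance i j) T'" for i j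
    proof (cases "distance i j T' \<le> r - \<epsilon>")
      case True with eps show ?thesis by simp
    next
      case False
      \<comment> \<open>A link in the band at \<open>T'\<close> was present just before, so its
        length is a limit of lengths at most \<open>r'\<close>; a bare strict bound by
        \<open>r\<close> would not survive the limit.\<close>
      have "\<forall>\<^sub>F s in at_left T'. linked r \<epsilon> (distance i j) s"
        using linked_iff_left_limit[OF eps(1) \<open>0 < T'\<close> distance_continuous[OF ij], of r] link False by auto
      moreover have "\<forall>\<^sub>F s in at_left T'. T \<le> s \<and> s < T'"
        using \<open>T < T'\<close> by (auto simp: eventually_at_left[of T T'] intro: exI[of _ T])
      ultimately have ev: "\<forall>\<^sub>F s in at_left T'. distance i j s \<le> r' \<and> r' < r"
        by eventually_elim (use bound ij in auto)
      then have "r' < r" using eventually_happens[OF ev] by auto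
      have "isCont (distance i j) T'"
        using distance_continuous[OF ij] \<open>0 < T'\<close> continuous_on_interior[of "{0..}" "distance i j" T'] by simp
      then have "(distance i j \<longlongrightarrow> distance i j T') (at_left T')"
        by (simp add: isCont_def filterlim_at_split)
      then have "distance i j T' \<le> r'"
        by (rule tendsto_upperbound) (use ev in \<open>auto elim: eventually_mono\<close>)
      with \<open>r' < r\<close> show ?thesis by simp
    qed
    then show ?thesis by (auto simp: controller_defined_def)
  qed
  \<comment> \<open>Definedness at \<open>T'\<close> persists to the right for each pair, hence for
    the finitely many pairs together.\<close>
  have "\<forall>\<^sub>F s in at_right T'. linked r \<epsilon> (distance i j) s \<longrightarrow> distance i j s < r"
    if ij: "i \<in> {1..N}" "j \<in> {1..N}" for i j
  proof -
    have "linked r \<epsilon> (distance i j) T' \<Longrightarrow> distance i j T' < r"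
      using defined_T' ij by (simp add: controller_defined_def)
    from link_distance_right_nhd[OF eps(1) distance_continuous[OF ij] \<open>0 \<le> T'\<close> this]
    obtain e where "T' < e" "\<And>\<tau>. \<tau> \<in> {T'..<e} \<Longrightarrow> linked r \<epsilon> (distance i j) \<tau> \<Longrightarrow> distance i j \<tau> < r"
      by blast
    then show ?thesis by (auto simp: eventually_at_right[of T' "T' + 1"] intro!: exI[of _ e])
  qed
  then have "\<forall>\<^sub>F s in at_right T'. controller_defined s"
    unfolding controller_defined_def by (intro eventually_ball_finite ballI) auto
  then obtain e where e: "T' < e" "\<And>s. T' < s \<Longrightarrow> s < e \<Longrightarrow> controller_defined s"
    using eventually_at_right[of T' "T' + 1"] by auto
  have "e \<le> T'" unfolding T'_def
  proof (rule cInf_greatest[OF B(1)])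
    fix s assume s: "s \<in> B"
    then have "T' \<le> s" unfolding T'_def using B(2) by (intro cInf_lower)
    with s defined_T' e(2)[of s] show "e \<le> s" by (force simp: B_def)
  qed
  with e(1) show False by simp
qed

section \<open>Persistence of the edges and of connectedness\<close>

lemma edges_mono:
  assumes "controller_defined T" "T \<le> t"
  shows "edges N r \<epsilon> x T \<subseteq> edges N r \<epsilon> x t"
proof (clarsimp simp: edges_def)
  fix i j assume ij: "Suc 0 \<le> i" "i \<le> N" "Suc 0 \<le> j" "j \<le> N" "linked r \<epsilon> (distance i j) T"
  then show "linked r \<epsilon> (distance i j) t"
    using controller_defined_always[OF assms(1)] assms(2)
    by - (rule linked_mono[OF eps(1) distance_continuous, of i j r T t], auto simp: controller_defined_def)
qed

end

text \<open>The vertex sets agree, so the graph at \<open>s\<close> is a connected spanning subgraph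
  of the graph at \<open>t\<close>.\<close>

lemma conn_graph_connected_mono:
  assumes "Digraph_Component.connected (with_proj (conn_graph N r \<epsilon> x s))"
    and "edges N r \<epsilon> x s \<subseteq> edges N r \<epsilon> x t"
  shows "Digraph_Component.connected (with_proj (conn_graph N r \<epsilon> x t))"
proof -
  interpret S: pair_pseudo_graph "conn_graph N r \<epsilon> x s" by (rule conn_graph_pseudo_graph)
  interpret G: pair_pseudo_graph "conn_graph N r \<epsilon> x t" by (rule conn_graph_pseudo_graph)
  have "spanning (with_proj (conn_graph N r \<epsilon> x s)) (with_proj (conn_graph N r \<epsilon> x t))"
    unfolding spanning_def subgraph_def
    using assms(2) S.wf_digraph G.wf_digraph by (simp add: conn_graph_def compatible_def)
  then show ?thesis using assms(1) by (rule G.connected_spanning_imp_connected)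
qed

theorem lemma1:
  fixes N l :: nat and r \<epsilon> T\<^sub>1 r_min :: real
    and x u :: "nat \<Rightarrow> real \<Rightarrow> real^2"
    and b :: "nat \<Rightarrow> real" and c :: "nat \<Rightarrow> real^2"
    and \<rho> :: "nat \<Rightarrow> real" and R :: "nat \<Rightarrow> (real^2) set"
  assumes "0 < r" and "0 < \<epsilon>" and "\<epsilon> < r" and "0 \<le> T\<^sub>1"
    and dynamics: "\<forall>i\<in>{1..N}. single_integrator (x i) (u i)"
    and connected_T1: "Digraph_Component.connected (with_proj (conn_graph N r \<epsilon> x T\<^sub>1))"
    and leader: "l \<in> {1..N}" "b l = 1" "\<forall>i\<in>{1..N}. i \<noteq> l \<longrightarrow> b i = 0"
    and goal: "R l = {y. norm (y - c l) \<le> \<rho> l}" "r_min \<le> \<rho> l" "0 < r_min"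
    and controller_defined_T1:
      "\<forall>(i, j)\<in>edges N r \<epsilon> x T\<^sub>1. norm (x i T\<^sub>1 - x j T\<^sub>1) < r"
    and controller: "\<forall>i\<in>{1..N}. \<forall>t\<ge>T\<^sub>1.
      u i t = - b i *\<^sub>R (x i t - c i)
        - (\<Sum>j\<in>nbrs N r \<epsilon> x t i.
            (2 * r\<^sup>2 / (r\<^sup>2 - (norm (x i t - x j t))\<^sup>2)\<^sup>2) *\<^sub>R (x i t - x j t))"
  shows "\<forall>t\<ge>T\<^sub>1. Digraph_Component.connected (with_proj (conn_graph N r \<epsilon> x t)) \<and>
    edges N r \<epsilon> x T\<^sub>1 \<subseteq> edges N r \<epsilon> x t"
proof (intro allI impI)
  fix t assume "T\<^sub>1 \<le> t"
  interpret controlled_network N r \<epsilon> T\<^sub>1 x u b c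
  proof unfold_locales
    show "0 \<le> b i" if "i \<in> {1..N}" for i
      using that leader by (cases "i = l") auto
  qed (use assms(2-4) dynamics controller in blast)+
  \<comment> \<open>The edge rule alone would admit a link of length exactly \<open>r\<close> at a
    positive time \<open>T\<^sub>1\<close>; excluding it starts the continuation argument.\<close>
  have "controller_defined T\<^sub>1"
    using controller_defined_T1 unfolding controller_defined_def edges_def by blast
  then have "edges N r \<epsilon> x T\<^sub>1 \<subseteq> edges N r \<epsilon> x t" using \<open>T\<^sub>1 \<le> t\<close> by (rule edges_mono)
  with connected_T1 show "Digraph_Component.connected (with_proj (conn_graph N r \<epsilon> x t)) \<and>
      edges N r \<epsilon> x T\<^sub>1 \<subseteq> edges N r \<epsilon> x t"
    using conn_graph_connected_mono by blast
qed

end
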